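(* The record-setters $v$ of the Stern sequence with $2^{k-1}\le v<2^k$ (the "$k$-bit record-setters") are, for $k<12$: $k=1$: $1$; $k=2$: $3$; $k=3$: $5$; $k=4$: $9, 11$; $k=5$: $19, 21$; $k=6$: $35, 37, 43$; $k=7$: $69, 73, 75, 83, 85$; $k=8$: $139, 147, 149, 165, 171$; $k=9$: $277, 293, 299, 331, 339, 341$; $k=10$: $555, 587, 595, 597, 661, 683$; $k=11$: $1109, 1173, 1189, 1195, 1323, 1355, 1363, 1365$. For $k\ge 12$, the $k$-bit record-setters, listed in increasing order, have the following base-$2$ representations: - if $k=2n$ is even: $100\,(10)^a\,0\,(10)^{n-3-a}\,11$ for $0\le a\le n-3$; then $(10)^b\,0\,(10)^{n-b-1}\,1$ for $1\le b\le\lfloor n/2\rfloor$; then $(10)^{n-1}\,11$. - if $k=2n+1$ is odd: $1000\,(10)^{n-2}\,1$; then $100100\,(10)^{n-4}\,011$; then $100\,(10)^b\,0\,(10)^{n-2-b}\,1$ for $1\le b\le\lceil n/2\rceil-1$; then $(10)^{a+1}\,0\,(10)^{n-2-a}\,11$ for $0\le a\le n-2$; then $(10)^n\,1$. In particular, for $k\ge 12$ the number of $k$-bit record-setters is $\lfloor 3k/4\rfloor-(-1)^k$. *)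

theory Defs
  imports Main
begin

text \<open>The Stern (diatomic) sequence: s(0)=0, s(1)=1, s(2n)=s(n), s(2n+1)=s(n)+s(n+1).\<close>
function stern :: "nat \<Rightarrow> nat" where
  "stern 0 = 0"
| "stern (Suc 0) = 1"
| "stern (Suc (Suc n)) =
     (if even n then stern (Suc (n div 2))
      else stern (Suc (n div 2)) + stern (Suc (Suc (n div 2))))"
  by pat_completeness auto
termination by (relation "measure id") (auto elim: oddE)

definition record_setter :: "nat \<Rightarrow> bool" where
  "record_setter v \<longleftrightarrow> (\<forall>i<v. stern i < stern v)"

definition rs_set :: "nat \<Rightarrow> nat set" where
  "rs_set k = {v. 2 ^ (k - 1) \<le> v \<and> v < 2 ^ k \<and> record_setter v}"

definition bin :: "nat list \<Rightarrow> nat" where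
  "bin ds = foldl (\<lambda>acc d. 2 * acc + d) 0 ds"

definition rep :: "nat \<Rightarrow> nat list \<Rightarrow> nat list" where
  "rep m w = concat (replicate m w)"

definition even_list :: "nat \<Rightarrow> nat list list" where
  "even_list n =
     [[1,0,0] @ rep a [1,0] @ [0] @ rep (n - 3 - a) [1,0] @ [1,1]. a \<leftarrow> [0..<n - 2]]
   @ [rep b [1,0] @ [0] @ rep (n - b - 1) [1,0] @ [1]. b \<leftarrow> [1..<n div 2 + 1]]
   @ [rep (n - 1) [1,0] @ [1,1]]"

definition odd_list :: "nat \<Rightarrow> nat list list" where
  "odd_list n =
     [[1,0,0,0] @ rep (n - 2) [1,0] @ [1]]
   @ [[1,0,0,1,0,0] @ rep (n - 4) [1,0] @ [0,1,1]]
   @ [[1,0,0] @ rep b [1,0] @ [0] @ rep (n - 2 - b) [1,0] @ [1]. b \<leftarrow> [1..<(n + 1) div 2]]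
   @ [rep (a + 1) [1,0] @ [0] @ rep (n - 2 - a) [1,0] @ [1,1]. a \<leftarrow> [0..<n - 1]]
   @ [rep n [1,0] @ [1]]"

end

theory Submission
  imports Defs "HOL-Number_Theory.Fib"
begin

text \<open>The Stern numbers at \<open>u\<close> and \<open>u + 1\<close> determine all those in the dyadic interval of numbers whose
  binary expansion starts with \<open>u\<close>. The maximum over such an interval is
  \<open>F_j min + F_{j+1} max\<close> of the two values, where \<open>j\<close> is the number of free digits, and from a node
  with increasing values it is attained at the alternating continuation \<open>1010...\<close> that ends in
  \<open>01\<close> or \<open>11\<close>. Hence whole subtrees whose maximum does not exceed the current record can be
  discarded. A record that precedes the alternating one leaves it at some \<open>(10)^i 0\<close>; comparing
  the maxima of these branches by d'Ocagne's identity \<open>F_m F_{n+1} - F_{m+1} F_n = (-1)^n F_{m-n}\<close> shows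
  that they are unimodal in \<open>i\<close>, increasing roughly up to the middle or throughout, according to parity.
  A second deviation gives no further records, except that those after the prefix \<open>100\<close> follow the
  same unimodal pattern, and that for odd lengths there is one exceptional record after \<open>100100\<close>.\<close>

section \<open>Records in a subtree of the Stern tree\<close>

lemma stern_double [simp]: "stern (2 * n) = stern n"
proof (cases n)
  case (Suc m)
  then show ?thesis by simp
qed simp

lemma stern_double_Suc [simp]: "stern (Suc (2 * n)) = stern n + stern (Suc n)"
proof (cases n)
  case (Suc m)
  then show ?thesis by simp
qed simp

fun row_max :: "nat \<Rightarrow> nat \<Rightarrow> nat \<Rightarrow> nat" where
  "row_max 0 p q = p"
| "row_max (Suc j) p q = max (row_max j p (p + q)) (row_max j (p + q) q)"

text \<open>Of the two children, the one that keeps the larger boundary value wins. Height 0 is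
  excluded since only the left boundary belongs to the row.\<close>

lemma row_max_Suc: "row_max (Suc j) p q = fib (Suc j) * min p q + fib (Suc (Suc j)) * max p q"
proof (induction j arbitrary: p q)
  case 0
  then show ?case by auto
next
  case (Suc j)
  show ?case
    by (subst row_max.simps, subst (1 2) Suc.IH)
      (cases "p \<le> q"; simp add: algebra_simps max_def min_def)
qed

text \<open>The digit strings \<open>w\<close> of length \<open>j\<close> for which the Stern number at \<open>u w\<close> exceeds \<open>m\<close> and
  all earlier entries \<open>u w'\<close>, where \<open>p\<close> and \<open>q\<close> are the Stern numbers at \<open>u\<close> and \<open>u + 1\<close>.\<close>

fun recs :: "nat \<Rightarrow> nat \<Rightarrow> nat \<Rightarrow> nat \<Rightarrow> nat list list" where
  "recs 0 m p q = (if m < p then [[]] else [])"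
| "recs (Suc j) m p q = map (Cons 0) (recs j m p (p + q)) @
     map (Cons 1) (recs j (max m (row_max j p (p + q))) (p + q) q)"

text \<open>The left maximum is at most \<open>m\<close>, so the right child inherits the threshold
  \<open>m\<close> unchanged.\<close>

lemma recs_pruned: "row_max j p q \<le> m \<Longrightarrow> recs j m p q = []"
  by (induction j arbitrary: m p q) (simp_all add: max.absorb1)

section \<open>Correctness of the recursion for records\<close>

definition row :: "nat \<Rightarrow> nat \<Rightarrow> nat set" where
  "row u j = {u * 2 ^ j ..< Suc u * 2 ^ j}"

lemma row_Suc: "row u (Suc j) = row (2 * u) j \<union> row (Suc (2 * u)) j"
proof -
  have "(2 * u) * 2 ^ j \<le> Suc (2 * u) * 2 ^ j" "Suc (2 * u) * 2 ^ j \<le> Suc (Suc (2 * u)) * 2 ^ j"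
    by simp_all
  then have "{(2 * u) * 2 ^ j ..< Suc (2 * u) * 2 ^ j} \<union>
      {Suc (2 * u) * 2 ^ j ..< Suc (Suc (2 * u)) * 2 ^ j} =
      {(2 * u) * 2 ^ j ..< Suc (Suc (2 * u)) * 2 ^ j}"
    by (rule ivl_disj_un_two)
  then show ?thesis
    by (simp add: row_def algebra_simps)
qed

lemma row_less: "v \<in> row u j \<Longrightarrow> w \<in> row (Suc u) j \<Longrightarrow> v < w"
  by (auto simp: row_def)

lemma row_max_eq: "row_max j (stern u) (stern (Suc u)) = Max (stern ` row u j)"
proof (induction j arbitrary: u)
  case 0
  have "row u 0 = {u}" by (auto simp: row_def)
  then show ?case by simp
next
  case (Suc j)
  have fin: "finite (row v j)" "row v j \<noteq> {}" for v by (auto simp: row_def)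
  have "Max (stern ` row u (Suc j)) = max (Max (stern ` row (2 * u) j)) (Max (stern ` row (Suc (2 * u)) j))"
    using fin by (simp add: row_Suc image_Un Max_Un)
  then show ?case
    using Suc.IH[of "2 * u"] Suc.IH[of "Suc (2 * u)"] stern_double[of "Suc u"] by simp
qed

lemma row_max_less_iff: "row_max j (stern u) (stern (Suc u)) < x \<longleftrightarrow> (\<forall>v\<in>row u j. stern v < x)"
proof -
  have "finite (row u j)" "row u j \<noteq> {}" by (auto simp: row_def)
  then show ?thesis by (simp add: row_max_eq)
qed

definition records :: "nat \<Rightarrow> nat \<Rightarrow> nat \<Rightarrow> nat set" where
  "records u j m = {v \<in> row u j. m < stern v \<and> (\<forall>w\<in>row u j. w < v \<longrightarrow> stern w < stern v)}"

text \<open>The left half precedes the right half, so its maximum acts as a further threshold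
  there.\<close>

lemma records_Suc:
  "records u (Suc j) m = records (2 * u) j m \<union>
     records (Suc (2 * u)) j (max m (row_max j (stern u) (stern u + stern (Suc u))))"
proof -
  have m: "max m (row_max j (stern u) (stern u + stern (Suc u))) < x \<longleftrightarrow>
      m < x \<and> (\<forall>w\<in>row (2 * u) j. stern w < x)" for x
    using row_max_less_iff[of j "2 * u" x] by simp
  show ?thesis
    unfolding records_def row_Suc m
    using row_less[of _ "2 * u" j] by (auto dest: less_imp_not_less)
qed

definition append_bits :: "nat \<Rightarrow> nat list \<Rightarrow> nat" where
  "append_bits u ds = foldl (\<lambda>acc d. 2 * acc + d) u ds"

lemma append_bits_simps [simp]: "append_bits u [] = u" "append_bits u (d # ds) = append_bits (2 * u + d) ds"
  by (simp_all add: append_bits_def)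

lemma recs_records:
  "sorted_wrt (<) (map (append_bits u) (recs j m (stern u) (stern (Suc u)))) \<and>
   set (map (append_bits u) (recs j m (stern u) (stern (Suc u)))) = records u j m"
proof (induction j arbitrary: u m)
  case 0
  have "row u 0 = {u}" by (auto simp: row_def)
  then show ?case by (auto simp: records_def)
next
  case (Suc j)
  let ?m = "max m (row_max j (stern u) (stern u + stern (Suc u)))"
  let ?A = "recs j m (stern u) (stern u + stern (Suc u))"
  let ?B = "recs j ?m (stern u + stern (Suc u)) (stern (Suc u))"
  have A: "sorted_wrt (<) (map (append_bits (2 * u)) ?A)"
      "set (map (append_bits (2 * u)) ?A) = records (2 * u) j m"
    using Suc.IH[of "2 * u" m] by simp_all
  have B: "sorted_wrt (<) (map (append_bits (Suc (2 * u))) ?B)"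
      "set (map (append_bits (Suc (2 * u))) ?B) = records (Suc (2 * u)) j ?m"
    using Suc.IH[of "Suc (2 * u)" ?m] stern_double[of "Suc u"] by simp_all
  have eq: "map (append_bits u) (recs (Suc j) m (stern u) (stern (Suc u))) =
      map (append_bits (2 * u)) ?A @ map (append_bits (Suc (2 * u))) ?B"
    by (simp add: o_def)
  have "\<forall>v\<in>records (2 * u) j m. \<forall>w\<in>records (Suc (2 * u)) j ?m. v < w"
    by (auto simp: records_def intro: row_less)
  then show ?case
    unfolding eq sorted_wrt_append set_append records_Suc using A B by simp
qed

text \<open>With leading zeros the tree is rooted at 0. The threshold \<open>fib k\<close> is the
  maximum over all shorter numbers and so enforces \<open>2 ^ (k - 1) \<le> v\<close>.\<close>

lemma rs_set_eq_records:
  assumes "2 \<le> k"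
  shows "rs_set k = records 0 k (fib k)"
proof -
  obtain j where k: "k = Suc (Suc j)"
    using assms by (metis add_2_eq_Suc le_Suc_ex)
  have "row_max (Suc j) (stern 0) (stern (Suc 0)) = fib k"
    unfolding row_max_Suc k by simp
  then have m: "fib k < x \<longleftrightarrow> (\<forall>v<2 ^ (k - 1). stern v < x)" for x
    using row_max_less_iff[of "Suc j" 0 x] by (auto simp: row_def k)
  have le: "2 ^ (k - Suc 0) \<le> v" if "\<forall>w<2 ^ (k - Suc 0). stern w < stern v" for v :: nat
    using that by (meson less_irrefl not_le)
  have r: "v \<in> row 0 k \<longleftrightarrow> v < 2 ^ k" for v by (simp add: row_def)
  show ?thesis
    unfolding rs_set_def records_def record_setter_def Ball_def m r
    by (auto intro: order.strict_trans1 dest!: le)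
qed

lemma rs_set_eq_recs:
  assumes "2 \<le> k"
  shows "rs_set k = set (map bin (recs k (fib k) 0 1))"
    and "sorted_list_of_set (rs_set k) = map bin (recs k (fib k) 0 1)"
proof -
  have bin: "append_bits 0 = bin" by (auto simp: append_bits_def bin_def)
  have s: "sorted_wrt (<) (map bin (recs k (fib k) 0 1))"
    and t: "set (map bin (recs k (fib k) 0 1)) = rs_set k"
    using recs_records[of 0 k "fib k"] assms by (simp_all add: bin rs_set_eq_records)
  show "rs_set k = set (map bin (recs k (fib k) 0 1))"
    using t by simp
  show "sorted_list_of_set (rs_set k) = map bin (recs k (fib k) 0 1)"
    using s unfolding t[symmetric]
    by (intro sorted_list_of_set.idem_if_sorted_distinct) (simp_all add: strict_sorted_iff)
qed

lemma rs_set_small: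
  "rs_set 2 = {3}" "rs_set 3 = {5}" "rs_set 4 = {9, 11}"
  "rs_set 5 = {19, 21}" "rs_set 6 = {35, 37, 43}"
  "rs_set 7 = {69, 73, 75, 83, 85}" "rs_set 8 = {139, 147, 149, 165, 171}"
  "rs_set 9 = {277, 293, 299, 331, 339, 341}"
  "rs_set 10 = {555, 587, 595, 597, 661, 683}"
  "rs_set 11 = {1109, 1173, 1189, 1195, 1323, 1355, 1363, 1365}"
  by (subst rs_set_eq_recs(1), simp, code_simp)+

text \<open>At a node with values \<open>p\<close> and \<open>q\<close>, every value in the subtree \<open>11\<close> is at most the
  maximum of the subtree \<open>10\<close>, so only the prefixes \<open>0\<close> and \<open>10\<close> can carry records.\<close>

lemma recs_step:
  "recs (Suc (Suc (Suc j))) m p q = map (Cons 0) (recs (Suc (Suc j)) m p (p + q)) @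
     map (\<lambda>w. 1 # 0 # w) (recs (Suc j) (max m (row_max (Suc (Suc j)) p (p + q))) (p + q) (p + 2 * q))"
proof -
  let ?m = "max m (row_max (Suc (Suc j)) p (p + q))"
  \<comment> \<open>Both subtrees have the larger value \<open>p + 2 * q\<close>; the smaller ones
    are \<open>q\<close> and \<open>p + q\<close>.\<close>
  have "row_max (Suc j) (p + 2 * q) q \<le> row_max (Suc j) (p + q) (p + 2 * q)"
    unfolding row_max_Suc by (simp add: max_def min_def)
  then have "recs (Suc j) (max ?m (row_max (Suc j) (p + q) (p + 2 * q))) (p + 2 * q) q = []"
    by (intro recs_pruned) (simp only: max.coboundedI2)
  moreover have "p + q + q = p + 2 * q" by simp
  ultimately show ?thesis
    by (subst recs.simps(2), subst (2) recs.simps(2)) (simp only: list.map append_Nil2 list.map_comp o_def)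
qed

declare recs.simps [simp del] row_max.simps [simp del]

section \<open>Alternating prefixes\<close>

text \<open>The Stern numbers at \<open>u (10)^i\<close> and its successor, when those at \<open>u\<close> and \<open>u + 1\<close>
  are \<open>p\<close> and \<open>p + e\<close>.\<close>

definition pre_fst :: "nat \<Rightarrow> nat \<Rightarrow> nat \<Rightarrow> nat" where
  "pre_fst p e i = p * fib (Suc (2 * i)) + e * fib (2 * i)"

definition pre_snd :: "nat \<Rightarrow> nat \<Rightarrow> nat \<Rightarrow> nat" where
  "pre_snd p e i = p * fib (Suc (Suc (2 * i))) + e * fib (Suc (2 * i))"

lemma pre_0 [simp]: "pre_fst p e 0 = p" "pre_snd p e 0 = p + e"
  by (simp_all add: pre_fst_def pre_snd_def)

lemma pre_Suc:
  "pre_fst p e (Suc i) = pre_fst p e i + pre_snd p e i"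
  "pre_snd p e (Suc i) = pre_fst p e i + 2 * pre_snd p e i"
  by (simp_all add: pre_fst_def pre_snd_def algebra_simps)

text \<open>The maximum of the subtree below the child \<open>0\<close> of a node with values \<open>p\<close> and \<open>q\<close>, with \<open>N\<close>
  digits left. For \<open>N = 0\<close> the right boundary value \<open>p + q\<close> is not part of the row.\<close>

definition branch_max :: "nat \<Rightarrow> nat \<Rightarrow> nat \<Rightarrow> nat" where
  "branch_max N p q = (if N = 0 then p else fib (Suc (Suc N)) * p + fib (Suc N) * q)"

lemma row_max_branch: "row_max N p (p + q) = branch_max N p q"
proof (cases N)
  case (Suc n)
  show ?thesis unfolding Suc row_max_Suc by (simp add: branch_max_def algebra_simps)
qed (simp add: branch_max_def row_max.simps)

lemma rep_0 [simp]: "rep 0 w = []"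
  by (simp add: rep_def)

lemma rep_Suc: "rep (Suc n) w = w @ rep n w"
  by (simp add: rep_def)

lemma rep_Suc_right: "rep (Suc n) w = rep n w @ w"
  by (induction n) (simp_all add: rep_def)

text \<open>Iterates \<open>recs_step\<close> along the path \<open>(10)^i\<close>. The caller
  supplies in closed form the record \<open>mm i\<close> to beat on entering branch
  \<open>i\<close>; \<open>N\<close> counts the digits after the \<open>0\<close> of that
  branch.\<close>

lemma recs_alternating:
  assumes "1 \<le> j"
    and "\<And>i N. i < r \<Longrightarrow> 2 * r + j = Suc (2 * i + N) \<Longrightarrow>
      mm (Suc i) = max (mm i) (branch_max N (pre_fst p e i) (pre_snd p e i))"
  shows "recs (2 * r + j) (mm 0) p (p + e) =
    concat (map (\<lambda>i. map (\<lambda>w. rep i [1,0] @ 0 # w)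
      (recs (2 * r + j - Suc (2 * i)) (mm i) (pre_fst p e i) (pre_fst p e i + pre_snd p e i))) [0..<r])
    @ map ((@) (rep r [1,0])) (recs j (mm r) (pre_fst p e r) (pre_snd p e r))"
  using assms
proof (induction r arbitrary: j)
  case 0
  then show ?case by (simp add: map_idI)
next
  case (Suc r)
  obtain j' where j: "j = Suc j'" using Suc.prems(1) by (cases j) auto
  have J: "2 * Suc r + j = 2 * r + Suc (Suc j)" by simp
  have mm: "mm (Suc r) = max (mm r) (row_max (Suc j) (pre_fst p e r) (pre_fst p e r + pre_snd p e r))"
    unfolding row_max_branch using Suc.prems(2)[of r "Suc j"] by simp
  have last: "recs (Suc (Suc j)) (mm r) (pre_fst p e r) (pre_snd p e r) =
      map (Cons 0) (recs (Suc j) (mm r) (pre_fst p e r) (pre_fst p e r + pre_snd p e r)) @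
      map (\<lambda>w. 1 # 0 # w) (recs j (mm (Suc r)) (pre_fst p e (Suc r)) (pre_snd p e (Suc r)))"
    unfolding mm pre_Suc j by (rule recs_step)
  have "recs (2 * r + Suc (Suc j)) (mm 0) p (p + e) =
    concat (map (\<lambda>i. map (\<lambda>w. rep i [1,0] @ 0 # w)
      (recs (2 * r + Suc (Suc j) - Suc (2 * i)) (mm i) (pre_fst p e i) (pre_fst p e i + pre_snd p e i))) [0..<r])
    @ map ((@) (rep r [1,0])) (recs (Suc (Suc j)) (mm r) (pre_fst p e r) (pre_snd p e r))"
    using Suc.prems by (intro Suc.IH) auto
  then show ?case
    unfolding J last by (simp add: rep_Suc_right o_def)
qed

text \<open>The parity of the length decides whether one or two digits remain at the end of the
  path.\<close>

lemma recs_last: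
  assumes "j \<in> {1, 2}" "branch_max (j - 1) p q \<le> m" "m < fib j * p + fib (Suc j) * q"
  shows "recs j m p q = [replicate j 1]"
  using assms by (auto simp: branch_max_def numeral_2_eq_2 recs.simps row_max.simps max_def)

text \<open>For increasing values and \<open>1 \<le> j\<close> this is the row maximum, and the path
  always follows a child attaining it.\<close>

lemma fib_pre_invariant:
  "fib j * pre_fst p e r + fib (Suc j) * pre_snd p e r = fib (2 * r + j) * p + fib (Suc (2 * r + j)) * (p + e)"
proof (induction r arbitrary: j)
  case (Suc r)
  show ?case using Suc.IH[of "Suc (Suc j)"] by (simp add: pre_Suc algebra_simps)
qed simp

text \<open>The two sides differ by \<open>fib N\<close> times the difference of the values at the
  node, positive because \<open>0 < e\<close>.\<close>

lemma branch_max_less_top: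
  assumes "0 < e" "1 \<le> N"
  shows "branch_max N (pre_fst p e i) (pre_snd p e i) <
    fib (Suc (2 * i + N)) * p + fib (Suc (Suc (2 * i + N))) * (p + e)"
proof -
  have "pre_fst p e i < pre_snd p e i"
    using assms by (induction i) (auto simp: pre_Suc)
  moreover have "0 < fib N" using assms by (simp add: fib_neq_0_nat)
  ultimately have "fib N * pre_fst p e i < fib N * pre_snd p e i" by (simp only: mult_less_cancel1)
  moreover have "branch_max N (pre_fst p e i) (pre_snd p e i) =
      fib (Suc N) * pre_fst p e i + fib N * pre_fst p e i + fib (Suc N) * pre_snd p e i"
    using assms by (simp add: branch_max_def distrib_right)
  moreover have "fib (Suc N) * pre_fst p e i + (fib (Suc N) * pre_snd p e i + fib N * pre_snd p e i) =
      fib (Suc (2 * i + N)) * p + fib (Suc (Suc (2 * i + N))) * (p + e)"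
    using fib_pre_invariant[of "Suc N" p e i] by (simp add: distrib_right)
  ultimately show ?thesis by linarith
qed

lemma recs_alternating_last:
  assumes j: "j \<in> {1, 2}"
    and mm: "\<And>i N. i < r \<Longrightarrow> 2 * r + j = Suc (2 * i + N) \<Longrightarrow>
      mm (Suc i) = max (mm i) (branch_max N (pre_fst p e i) (pre_snd p e i))"
    and le: "branch_max (j - 1) (pre_fst p e r) (pre_snd p e r) \<le> mm r"
    and less: "mm r < fib (2 * r + j) * p + fib (Suc (2 * r + j)) * (p + e)"
  shows "recs (2 * r + j) (mm 0) p (p + e) =
    concat (map (\<lambda>i. map (\<lambda>w. rep i [1,0] @ 0 # w)
      (recs (2 * r + j - Suc (2 * i)) (mm i) (pre_fst p e i) (pre_fst p e i + pre_snd p e i))) [0..<r])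
    @ [rep r [1,0] @ replicate j 1]"
proof -
  have "recs j (mm r) (pre_fst p e r) (pre_snd p e r) = [replicate j 1]"
    using less by (intro recs_last j le) (simp add: fib_pre_invariant)
  moreover have "recs (2 * r + j) (mm 0) p (p + e) =
    concat (map (\<lambda>i. map (\<lambda>w. rep i [1,0] @ 0 # w)
      (recs (2 * r + j - Suc (2 * i)) (mm i) (pre_fst p e i) (pre_fst p e i + pre_snd p e i))) [0..<r])
    @ map ((@) (rep r [1,0])) (recs j (mm r) (pre_fst p e r) (pre_snd p e r))"
    using j by (intro recs_alternating mm) auto
  ultimately show ?thesis by simp
qed

lemma recs_single:
  assumes j: "j \<in> {1, 2}"
    and p: "p \<le> m"
    and le: "\<And>i N. 2 * r + j = Suc (2 * i + N) \<Longrightarrow> 1 \<le> N \<Longrightarrow>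
      branch_max N (pre_fst p e i) (pre_snd p e i) \<le> m"
    and less: "m < fib (2 * r + j) * p + fib (Suc (2 * r + j)) * (p + e)"
  shows "recs (2 * r + j) m p (p + e) = [rep r [1,0] @ replicate j 1]"
proof -
  have le': "branch_max N (pre_fst p e i) (pre_snd p e i) \<le> m" if "2 * r + j = Suc (2 * i + N)" for i N
  proof (cases N)
    case 0
    show ?thesis
    proof (cases i)
      case (Suc i')
      \<comment> \<open>With no digits left the branch is the single value \<open>P + Q\<close> from
        the previous node, whose own branch reaches \<open>3 P + 2 Q\<close>.\<close>
      have "branch_max 2 (pre_fst p e i') (pre_snd p e i') \<le> m"
        using that by (intro le) (auto simp: 0 Suc)
      then show ?thesis by (simp add: 0 Suc pre_Suc branch_max_def numeral_2_eq_2)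
    qed (simp add: 0 branch_max_def p)
  next
    case (Suc n)
    then show ?thesis using le that by simp
  qed
  have "recs (2 * r + j - Suc (2 * i)) m (pre_fst p e i) (pre_fst p e i + pre_snd p e i) = []" if "i < r" for i
    using that by (intro recs_pruned, unfold row_max_branch, intro le') auto
  then have "concat (map (\<lambda>i. map (\<lambda>w. rep i [1,0] @ 0 # w)
      (recs (2 * r + j - Suc (2 * i)) m (pre_fst p e i) (pre_fst p e i + pre_snd p e i))) [0..<r]) = []"
    by simp
  moreover have "branch_max (j - 1) (pre_fst p e r) (pre_snd p e r) \<le> m"
    using j by (intro le') auto
  ultimately show ?thesis
    using recs_alternating_last[where mm = "\<lambda>_. m" and r = r and j = j and p = p and e = e] le' j less
    by (simp add: max.absorb1)
qed

section \<open>Fibonacci inequalities\<close>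

lemma fib_le_Suc_double: "fib (Suc (Suc n)) \<le> 2 * fib (Suc n)"
  using fib_Suc_mono[of n] by simp

lemma fib_even_bound: "8 * fib (2 * i) \<le> 5 * fib (Suc (2 * i))"
  proof (induction i)
  case (Suc i)
  then have "3 * fib (2 * i) \<le> 2 * fib (Suc (2 * i))" by linarith
  then show ?case by simp
qed simp

text \<open>Starts at index 3: the ratio at index 2 is 2, hence the exception \<open>N = 2\<close>
  below.\<close>

lemma fib_ratio_bound: "3 * fib (Suc (Suc (Suc (Suc n)))) \<le> 5 * fib (Suc (Suc (Suc n)))"
  using fib_Suc_mono[of n] by simp

lemma fib_add4:
  "fib (Suc (Suc (Suc (Suc (n + k))))) =
    3 * fib (Suc n) * fib (Suc k) + 2 * fib n * fib (Suc k) + 2 * fib (Suc n) * fib k + fib n * fib k"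
  using fib_add[of n "Suc (Suc (Suc k))"] by (simp add: algebra_simps)

text \<open>Compares the subtrees \<open>u 0\<close> and \<open>u 10 (10)^i 0\<close>, where \<open>P\<close> and \<open>Q\<close> are the values at \<open>u\<close> and
  \<open>u + 1\<close> and \<open>N\<close> digits are left in the second one.\<close>

lemma dominance_gap:
  fixes i N P Q :: nat
  defines "w \<equiv> int (fib (2 * i))" and "t \<equiv> int (fib (Suc (2 * i)))"
    and "f \<equiv> int (fib N)" and "h \<equiv> int (fib (Suc N))"
  assumes "1 \<le> N"
  shows "int (branch_max (2 * i + N + 3) P Q) =
    int (branch_max N (pre_fst (P + Q) (P + 2 * Q) i) (pre_snd (P + Q) (P + 2 * Q) i))
    + int P * (2 * t * (f + h) + w * (f + h)) + int Q * (t * f - (t * h + w * (f + h)))"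
proof -
  have 1: "fib (Suc (Suc (2 * i + N + 3))) = fib (Suc (Suc (Suc (Suc (2 * i + N))))) + fib (Suc (Suc (Suc (2 * i + N))))"
    "fib (Suc (2 * i + N + 3)) = fib (Suc (Suc (Suc (Suc (2 * i + N)))))"
    by (simp_all add: add.commute[of _ 3] numeral_3_eq_3)
  have 2: "fib (Suc (Suc (Suc (2 * i + N)))) = 2 * fib (Suc (2 * i)) * fib (Suc N) + fib (2 * i) * fib (Suc N)
     + fib (Suc (2 * i)) * fib N + fib (2 * i) * fib N"
    using fib_add[of "2 * i" "Suc (Suc N)"] by (simp add: algebra_simps)
  have "2 * i + N + 3 \<noteq> 0" "N \<noteq> 0" using assms by auto
  then show ?thesis
    unfolding branch_max_def 1 2 fib_add4 pre_fst_def pre_snd_def assms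
    by (simp add: algebra_simps)
qed

text \<open>The node \<open>u 100\<close> has the values \<open>P + Q\<close> and
  \<open>2 P + 3 Q\<close>, so a second deviation \<open>u 100 (10)^i 0\<close> never beats
  \<open>u 0\<close>. In the worst case \<open>Q = 2 P\<close> the gap is
  \<open>P (4 t f - w (f + h))\<close>.\<close>

lemma branch_dominated:
  assumes "Q \<le> 2 * P" "1 \<le> N"
  shows "branch_max N (pre_fst (P + Q) (P + 2 * Q) i) (pre_snd (P + Q) (P + 2 * Q) i)
    \<le> branch_max (2 * i + N + 3) P Q"
proof -
  define w t f h where wt: "w = int (fib (2 * i))" "t = int (fib (Suc (2 * i)))"
    "f = int (fib N)" "h = int (fib (Suc N))"
  have "0 \<le> w" "w \<le> t" "0 \<le> f" "f \<le> h" by (simp_all add: wt fib_Suc_mono)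
  have "h \<le> 2 * f"
    unfolding wt using fib_le_Suc_double[of "N - 1"] assms(2) by simp
  have "w * (f + h) \<le> t * (4 * f)"
    using \<open>0 \<le> w\<close> \<open>w \<le> t\<close> \<open>0 \<le> f\<close> \<open>f \<le> h\<close> \<open>h \<le> 2 * f\<close> by (intro mult_mono) auto
  moreover have "0 \<le> t * h - t * f + w * (f + h)"
    using \<open>0 \<le> w\<close> \<open>w \<le> t\<close> \<open>0 \<le> f\<close> \<open>f \<le> h\<close> by (simp add: mult_left_mono)
  then have "int Q * (t * h - t * f + w * (f + h)) \<le> int (2 * P) * (t * h - t * f + w * (f + h))"
    using assms(1) by (intro mult_right_mono) linarith+
  moreover have "int P * (w * (f + h)) \<le> int P * (t * (4 * f))"
    using calculation(1) by (intro mult_left_mono) auto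
  ultimately have "0 \<le> int P * (2 * t * (f + h) + w * (f + h)) + int Q * (t * f - (t * h + w * (f + h)))"
    by (simp add: algebra_simps)
  then show ?thesis
    using dominance_gap[of N i P Q] assms(2) unfolding wt by linarith
qed

text \<open>The bound of the previous lemma on the ratio fails at \<open>u = 100\<close>, and so does the conclusion for
  \<open>N = 2\<close>: this produces the exceptional record \<open>100100 (10)^(n-4) 011\<close>.\<close>

lemma branch_dominated_1_3:
  assumes "1 \<le> N" "N \<noteq> 2"
  shows "branch_max N (pre_fst 4 7 i) (pre_snd 4 7 i) \<le> branch_max (2 * i + N + 3) 1 3"
proof -
  define w t f h where wt: "w = int (fib (2 * i))" "t = int (fib (Suc (2 * i)))"
    "f = int (fib N)" "h = int (fib (Suc N))"
  have "0 \<le> w" "8 * w \<le> 5 * t" "0 \<le> f" "0 \<le> h"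
    using fib_even_bound[of i] by (simp_all add: wt)
  have "3 * h \<le> 5 * f"
  proof (cases "N = 1")
    case True
    then show ?thesis by (simp add: wt)
  next
    case False
    then have "3 \<le> N" using assms by linarith
    then obtain n where "N = Suc (Suc (Suc n))" by (metis Suc_le_D numeral_3_eq_3 Suc_le_mono)
    then show ?thesis using fib_ratio_bound[of n] unfolding wt by (simp del: fib.simps)
  qed
  then have "t * (3 * h) \<le> t * (5 * f)"
    by (intro mult_left_mono) (auto simp: wt)
  moreover have "8 * w * (f + h) \<le> 5 * t * (f + h)"
    using \<open>8 * w \<le> 5 * t\<close> \<open>0 \<le> f\<close> \<open>0 \<le> h\<close> by (intro mult_right_mono) auto
  \<comment> \<open>The gap is \<open>5 t f - t h - 2 w (f + h)\<close>; by
    \<open>8 w \<le> 5 t\<close> it is at least 3/4 of \<open>t (5 f - 3 h)\<close>.\<close>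
  ultimately have "0 \<le> (2 * t * (f + h) + w * (f + h)) + 3 * (t * f - (t * h + w * (f + h)))"
    by (simp add: algebra_simps)
  moreover have "int (branch_max (2 * i + N + 3) 1 3) = int (branch_max N (pre_fst 4 7 i) (pre_snd 4 7 i))
      + (2 * t * (f + h) + w * (f + h)) + 3 * (t * f - (t * h + w * (f + h)))"
    using dominance_gap[of N i 1 3] assms(1) unfolding wt by simp
  ultimately show ?thesis by linarith
qed

text \<open>Meant for the prefix \<open>1000\<close>, with values 1 and 4: no branch below it beats
  the initial record \<open>fib k\<close>. The margin is \<open>2 t f - w (f + h)\<close>.\<close>

lemma branch_dominated_fib:
  assumes "1 \<le> N"
  shows "branch_max N (pre_fst 1 3 i) (pre_snd 1 3 i) \<le> fib (2 * i + N + 5)"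
proof -
  define w t f h where wt: "w = fib (2 * i)" "t = fib (Suc (2 * i))"
    "f = fib N" "h = fib (Suc N)"
  have "8 * w \<le> 5 * t" "h \<le> 2 * f"
    using fib_even_bound[of i] fib_le_Suc_double[of "N - 1"] assms by (simp_all add: wt)
  have "w * h \<le> 2 * (w * f)"
    using mult_le_mono2[OF \<open>h \<le> 2 * f\<close>, of w] by (simp only: mult.left_commute)
  moreover have "8 * (w * f) \<le> 5 * (t * f)"
    using mult_le_mono1[OF \<open>8 * w \<le> 5 * t\<close>, of f] by (simp only: mult.assoc)
  moreover have "2 * i + N + 5 = Suc (Suc (Suc (Suc (Suc (2 * i + N)))))" by simp
  then have "fib (2 * i + N + 5) = fib (Suc (Suc (Suc (Suc (2 * i + N))))) + fib (Suc (Suc (Suc (2 * i + N))))"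
    by (simp only: fib2)
  then have "fib (2 * i + N + 5) = 5 * (t * h) + 3 * (w * h) + 3 * (t * f) + 2 * (w * f)"
    using fib_add[of "2 * i" "Suc (Suc N)"] unfolding fib_add4 by (simp add: wt algebra_simps)
  moreover have "branch_max N (pre_fst 1 3 i) (pre_snd 1 3 i) = 5 * (t * h) + 4 * (w * h) + t * f + 3 * (w * f)"
    using assms by (simp add: branch_max_def pre_fst_def pre_snd_def wt algebra_simps)
  ultimately show ?thesis by linarith
qed

section \<open>Differences of consecutive branch maxima\<close>

lemma fib_dOcagne:
  "int (fib m) * int (fib (Suc (m + d))) - int (fib (Suc m)) * int (fib (m + d)) = - ((-1) ^ m * int (fib d))"
proof (induction m)
  case (Suc m)
  have "fib (Suc (Suc m + d)) = fib (Suc (m + d)) + fib (m + d)" "fib (Suc (Suc m)) = fib (Suc m) + fib m"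
    by simp_all
  then have "int (fib (Suc m)) * int (fib (Suc (Suc m + d))) - int (fib (Suc (Suc m))) * int (fib (Suc m + d)) =
      - (int (fib m) * int (fib (Suc (m + d))) - int (fib (Suc m)) * int (fib (m + d)))"
    by (simp only: of_nat_add add_Suc) (simp add: algebra_simps del: fib.simps)
  then show ?case using Suc.IH by simp
qed simp

text \<open>All cancels but a 2 by 2 determinant, which d'Ocagne's identity evaluates for Fibonacci
  numbers \<open>P\<close> and \<open>Q\<close>.\<close>

lemma branch_max_step:
  "1 \<le> N \<Longrightarrow> int (branch_max N (P + Q) (P + 2 * Q)) - int (branch_max (Suc (Suc N)) P Q) =
    int Q * int (fib (Suc N)) - int P * int (fib (Suc (Suc N)))"
  by (simp add: branch_max_def algebra_simps)

section \<open>Unimodal sequences of branch maxima\<close>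

text \<open>The maximum of the subtree \<open>u (10)^i 0\<close> inside the subtree of height \<open>J\<close> below \<open>u\<close>.\<close>

definition peak :: "nat \<Rightarrow> nat \<Rightarrow> nat \<Rightarrow> nat \<Rightarrow> nat" where
  "peak J p e i = branch_max (J - Suc (2 * i)) (pre_fst p e i) (pre_snd p e i)"

lemma peak_Suc_diff:
  assumes "J = 2 * i + N + 3" "1 \<le> N"
  shows "int (peak J p e (Suc i)) - int (peak J p e i) =
    int (pre_snd p e i) * int (fib (Suc N)) - int (pre_fst p e i) * int (fib (Suc (Suc N)))"
proof -
  have "J - Suc (2 * Suc i) = N" "J - Suc (2 * i) = Suc (Suc N)" using assms by auto
  then show ?thesis
    unfolding peak_def pre_Suc using branch_max_step[OF assms(2)] by simp
qed

lemma peak_Suc_le_last: "peak (2 * i + 3) p e (Suc i) \<le> peak (2 * i + 3) p e i"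
  by (simp add: peak_def pre_Suc branch_max_def eval_nat_numeral)

lemma recs_peak_single:
  assumes "j \<in> {1, 2}"
    and less: "peak (2 * r + j) p e (Suc i) > peak (2 * r + j) p e i"
    and "Suc i < r" and Q: "pre_snd p e i \<le> 2 * pre_fst p e i"
  shows "recs (2 * r + j - Suc (2 * Suc i)) (peak (2 * r + j) p e i) (pre_fst p e (Suc i))
      (pre_fst p e (Suc i) + pre_snd p e (Suc i)) = [rep (r + j - 3 - i) [1,0] @ replicate (3 - j) 1]"
proof -
  define s where "s = r - i - 2"
  have s: "r = i + s + 2" using assms(3) by (simp add: s_def)
  \<comment> \<open>A branch uses up an odd number of digits, so the ending switches between
    \<open>1\<close> and \<open>11\<close>.\<close>
  define r' j' where r': "r' = s + j - 1" "j' = 3 - j"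
  have j': "j' \<in> {1, 2}" and J: "2 * r + j - Suc (2 * Suc i) = 2 * r' + j'"
    and J2: "2 * r + j - Suc (2 * i) = 2 * r' + j' + 2" and "r + j - 3 - i = r'"
    using assms(1) s by (auto simp: r')
  let ?P = "pre_fst p e i" and ?Q = "pre_snd p e i"
  let ?m = "branch_max (2 * r' + j' + 2) ?P ?Q"
  have "recs (2 * r' + j') ?m (?P + ?Q) ((?P + ?Q) + (?P + 2 * ?Q)) = [rep r' [1,0] @ replicate j' 1]"
  proof (rule recs_single[OF j'])
    have "?P + ?Q \<le> fib (Suc (Suc n)) * ?P + fib (Suc n) * ?Q" for n
      by (intro add_mono) (simp_all add: Suc_leI fib_neq_0_nat del: fib.simps)
    from this[of "2 * r' + j' + 2"] show "?P + ?Q \<le> ?m"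
      by (simp add: branch_max_def del: fib.simps)
  next
    fix i' N assume N: "2 * r' + j' = Suc (2 * i' + N)" "1 \<le> N"
    have eq: "2 * r' + j' + 2 = 2 * i' + N + 3" using N(1) by simp
    show "branch_max N (pre_fst (?P + ?Q) (?P + 2 * ?Q) i') (pre_snd (?P + ?Q) (?P + 2 * ?Q) i') \<le> ?m"
      unfolding eq by (rule branch_dominated[OF Q N(2)])
  next
    have "?m < branch_max (2 * r' + j') (?P + ?Q) (?P + 2 * ?Q)"
      using less unfolding peak_def J J2 pre_Suc by simp
    then show "?m < fib (2 * r' + j') * (?P + ?Q) + fib (Suc (2 * r' + j')) * (?P + ?Q + (?P + 2 * ?Q))"
      using j' by (auto simp: branch_max_def algebra_simps)
  qed
  then show ?thesis
    unfolding peak_def J J2 pre_Suc \<open>r + j - 3 - i = r'\<close> r'(2)[symmetric] by simp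
qed

lemma upt_split: "i \<le> j \<Longrightarrow> j \<le> k \<Longrightarrow> [i..<k] = [i..<j] @ [j..<k]"
  using upt_add_eq_append[of i j "k - j"] by simp

text \<open>As long as the branch maxima increase, each branch \<open>(10)^i 0\<close> with \<open>2 \<le> i\<close> contributes exactly
  its maximum, because everything before that maximum is dominated by the preceding branch.\<close>

lemma recs_unimodal:
  assumes j: "j \<in> {1, 2}" and e: "0 < e" and c: "1 \<le> c" "c < r"
    and m: "m \<le> peak (2 * r + j) p e 0"
    and inc: "\<And>i. i < c \<Longrightarrow> peak (2 * r + j) p e i < peak (2 * r + j) p e (Suc i)"
    and dec: "\<And>i. c \<le> i \<Longrightarrow> i < r \<Longrightarrow> peak (2 * r + j) p e (Suc i) \<le> peak (2 * r + j) p e i"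
  shows "recs (2 * r + j) m p (p + e) =
    map (Cons 0) (recs (2 * r + j - 1) m p (p + (p + e)))
    @ map (\<lambda>w. 1 # 0 # 0 # w) (recs (2 * r + j - 3) (peak (2 * r + j) p e 0)
        (2 * p + e) ((2 * p + e) + (3 * p + 2 * e)))
    @ [rep i [1,0] @ [0] @ rep (r + j - 2 - i) [1,0] @ replicate (3 - j) 1. i \<leftarrow> [2..<Suc c]]
    @ [rep r [1,0] @ replicate j 1]"
proof -
  let ?V = "peak (2 * r + j) p e"
  \<comment> \<open>The record to beat follows the peaks up to branch \<open>c\<close> and is frozen
    from there on.\<close>
  define mm where "mm i = (if i = 0 then m else ?V (min (i - 1) c))" for i
  let ?f = "\<lambda>i. map (\<lambda>w. rep i [1,0] @ 0 # w)
      (recs (2 * r + j - Suc (2 * i)) (mm i) (pre_fst p e i) (pre_fst p e i + pre_snd p e i))"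
  have le_c: "?V i \<le> ?V c" if "c \<le> i" "i \<le> r" for i
    using that by (induction i rule: dec_induct) (auto intro: order.trans[OF dec])
  have mono: "mm (Suc i) = max (mm i) (?V i)" if "i \<le> r" for i
  proof (cases i)
    case (Suc i')
    show ?thesis
    proof (cases "i \<le> c")
      case True
      then show ?thesis using inc[of i'] by (simp add: mm_def Suc max_def)
    next
      case False
      then show ?thesis using le_c[of i] that by (simp add: mm_def Suc max_def)
    qed
  qed (use m in \<open>simp add: mm_def\<close>)
  have top: "?V c < fib (2 * r + j) * p + fib (Suc (2 * r + j)) * (p + e)"
  proof -
    define N where "N = 2 * r + j - Suc (2 * c)"
    have N: "2 * r + j = Suc (2 * c + N)" "1 \<le> N"
      using c j by (auto simp: N_def)
    then have "2 * r + j - Suc (2 * c) = N" by simp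
    then show ?thesis
      unfolding peak_def N(1) using branch_max_less_top[OF e N(2), of p c] by simp
  qed
  have "recs (2 * r + j) (mm 0) p (p + e) = concat (map ?f [0..<r]) @ [rep r [1,0] @ replicate j 1]"
  proof (rule recs_alternating_last[OF j])
    fix i N assume "i < r" "2 * r + j = Suc (2 * i + N)"
    then show "mm (Suc i) = max (mm i) (branch_max N (pre_fst p e i) (pre_snd p e i))"
      using mono[of i] by (simp add: peak_def)
  next
    have "?V r \<le> mm (Suc r)" using mono[of r] by simp
    also have "mm (Suc r) = mm r" using c by (simp add: mm_def)
    finally show "branch_max (j - 1) (pre_fst p e r) (pre_snd p e r) \<le> mm r"
      by (simp add: peak_def)
  next
    show "mm r < fib (2 * r + j) * p + fib (Suc (2 * r + j)) * (p + e)"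
      using top c by (simp add: mm_def)
  qed
  \<comment> \<open>Branches 0 and 1 stay unevaluated: the bound \<open>Q \<le> 2 P\<close> at the
    preceding node needs a block \<open>10\<close> before it.\<close>
  moreover have "[0..<r] = [0, 1] @ [2..<Suc c] @ [Suc c..<r]"
  proof -
    have "[0..<r] = [0..<2] @ [2..<r]" "[2..<r] = [2..<Suc c] @ [Suc c..<r]"
      using c by (intro upt_split; simp)+
    then show ?thesis by (simp add: upt_rec numeral_2_eq_2)
  qed
  moreover have "?f i = []" if "i \<in> {Suc c..<r}" for i
  proof -
    have "row_max (2 * r + j - Suc (2 * i)) (pre_fst p e i) (pre_fst p e i + pre_snd p e i) \<le> mm i"
      unfolding row_max_branch using le_c[of i] that by (auto simp: mm_def peak_def[symmetric])
    then show ?thesis by (simp add: recs_pruned)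
  qed
  then have "concat (map ?f [Suc c..<r]) = []" by simp
  moreover have "?f i = [rep i [1,0] @ [0] @ rep (r + j - 2 - i) [1,0] @ replicate (3 - j) 1]"
    if "i \<in> {2..<Suc c}" for i
  proof -
    define i' where "i' = i - 2"
    have "2 \<le> i" using that by simp
    then have i': "i = Suc (Suc i')" unfolding i'_def by arith
    have "pre_snd p e (Suc i') \<le> 2 * pre_fst p e (Suc i')" by (simp add: pre_Suc)
    then have "recs (2 * r + j - Suc (2 * Suc (Suc i'))) (?V (Suc i')) (pre_fst p e (Suc (Suc i')))
      (pre_fst p e (Suc (Suc i')) + pre_snd p e (Suc (Suc i'))) = [rep (r + j - 3 - Suc i') [1,0] @ replicate (3 - j) 1]"
      using that inc[of "Suc i'"] c by (intro recs_peak_single j) (auto simp: i')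
    moreover have "r + j - 3 - Suc i' = r + j - 2 - i" by (simp add: i')
    moreover have "mm i = ?V (Suc i')" using that by (simp add: mm_def i')
    ultimately show ?thesis by (simp add: i')
  qed
  then have "map ?f [2..<Suc c] =
      [[rep i [1,0] @ [0] @ rep (r + j - 2 - i) [1,0] @ replicate (3 - j) 1]. i \<leftarrow> [2..<Suc c]]"
    by (intro map_cong refl) (simp only: set_upt)
  then have "concat (map ?f [2..<Suc c]) =
      [rep i [1,0] @ [0] @ rep (r + j - 2 - i) [1,0] @ replicate (3 - j) 1. i \<leftarrow> [2..<Suc c]]"
    by (simp only: concat_map_singleton)
  moreover have "?f 0 = map (Cons 0) (recs (2 * r + j - 1) m p (p + (p + e)))"
    by (simp add: mm_def)
  moreover have "?f 1 = map (\<lambda>w. 1 # 0 # 0 # w) (recs (2 * r + j - 3) (?V 0)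
        (2 * p + e) ((2 * p + e) + (3 * p + 2 * e)))"
    by (simp add: mm_def pre_Suc rep_Suc eval_nat_numeral algebra_simps)
  moreover have "mm 0 = m" by (simp add: mm_def)
  ultimately show ?thesis by simp
qed

section \<open>The prefixes 1, 100 and 100100\<close>

lemma pre_0_1: "pre_fst 0 1 i = fib (2 * i)" "pre_snd 0 1 i = fib (Suc (2 * i))"
  by (simp_all add: pre_fst_def pre_snd_def)

lemma pre_1_2:
  "pre_fst 1 2 i = 2 * fib (2 * i) + fib (Suc (2 * i))"
  "pre_snd 1 2 i = fib (2 * i) + 3 * fib (Suc (2 * i))"
  by (simp_all add: pre_fst_def pre_snd_def)

text \<open>The difference is a signed Fibonacci number: positive up to the middle, and beyond it
  with a sign given by the parity of \<open>N\<close>.\<close>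

lemma peak_0_1_increasing:
  assumes J: "J = 2 * i + N + 3" "1 \<le> N" and "2 * i \<le> N \<or> even N"
  shows "peak J 0 1 i < peak J 0 1 (Suc i)"
proof (cases "2 * i \<le> N")
  case True
  define d where "d = N - 2 * i"
  have N: "Suc N = 2 * i + Suc d" "Suc (Suc N) = Suc (2 * i + Suc d)" using True by (simp_all add: d_def)
  have "int (peak J 0 1 (Suc i)) - int (peak J 0 1 i) = int (fib (Suc d))"
    unfolding peak_Suc_diff[OF J] pre_0_1 N using fib_dOcagne[of "2 * i" "Suc d"] by (simp del: fib.simps)
  moreover have "0 < fib (Suc d)" by (simp add: fib_neq_0_nat)
  ultimately show ?thesis by linarith
next
  case False
  then have "even N" using assms by simp
  define d where "d = 2 * i - Suc N"
  have i: "2 * i = Suc N + d" using False by (simp add: d_def)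
  then have "odd d" using \<open>even N\<close> by presburger
  have "int (peak J 0 1 (Suc i)) - int (peak J 0 1 i) = int (fib d)"
    unfolding peak_Suc_diff[OF J] pre_0_1 i using fib_dOcagne[of "Suc N" d] \<open>even N\<close>
    by (simp add: mult.commute del: fib.simps)
  moreover have "0 < fib d" using \<open>odd d\<close> by (intro fib_neq_0_nat) (auto intro: Nat.gr0I)
  ultimately show ?thesis by linarith
qed

text \<open>At \<open>2 * i = Suc N\<close> the peaks tie; a tie sets no record, so the weak
  inequality suffices.\<close>

lemma peak_0_1_decreasing:
  assumes J: "J = 2 * i + N + 3" "1 \<le> N" and "N < 2 * i" "odd N"
  shows "peak J 0 1 (Suc i) \<le> peak J 0 1 i"
proof -
  define d where "d = 2 * i - Suc N"
  have i: "2 * i = Suc N + d" using assms(3) by (simp add: d_def)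
  have "int (peak J 0 1 (Suc i)) - int (peak J 0 1 i) = - int (fib d)"
    unfolding peak_Suc_diff[OF J] pre_0_1 i using fib_dOcagne[of "Suc N" d] \<open>odd N\<close>
    by (simp add: mult.commute del: fib.simps)
  then show ?thesis by linarith
qed

text \<open>Regrouped for the node \<open>100\<close>, with values 1 and 3, into two determinants
  that d'Ocagne's identity evaluates.\<close>

lemma peak_1_2_diff:
  assumes J: "J = 2 * i + N + 3" "1 \<le> N"
  shows "int (peak J 1 2 (Suc i)) - int (peak J 1 2 i) =
    3 * (int (fib (Suc (2 * i))) * int (fib (Suc N)) - int (fib (2 * i)) * int (fib (Suc (Suc N))))
    + (int (fib (2 * i)) * int (fib (Suc (Suc (Suc N)))) - int (fib (Suc (2 * i))) * int (fib (Suc (Suc N))))"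
proof -
  have "int (fib (Suc (Suc (Suc N)))) = int (fib (Suc (Suc N))) + int (fib (Suc N))" by simp
  then show ?thesis
    unfolding peak_Suc_diff[OF J] pre_1_2 by (simp add: algebra_simps del: fib.simps)
qed

lemma peak_1_2_increasing:
  assumes J: "J = 2 * i + N + 3" "1 \<le> N" and "2 * i \<le> N \<or> even N"
  shows "peak J 1 2 i < peak J 1 2 (Suc i)"
proof (cases "2 * i \<le> N")
  case True
  define d where "d = N - 2 * i"
  have N: "Suc N = 2 * i + Suc d" "Suc (Suc N) = Suc (2 * i + Suc d)" "Suc (Suc N) = 2 * i + Suc (Suc d)"
    "Suc (Suc (Suc N)) = Suc (2 * i + Suc (Suc d))"
    using True by (simp_all add: d_def)
  have "int (peak J 1 2 (Suc i)) - int (peak J 1 2 i) = 3 * int (fib (Suc d)) - int (fib (Suc (Suc d)))"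
    using fib_dOcagne[of "2 * i" "Suc d"] fib_dOcagne[of "2 * i" "Suc (Suc d)"]
    unfolding peak_1_2_diff[OF J] N(1,2,4)[symmetric] N(3)[symmetric] by (simp add: mult.commute del: fib.simps)
  moreover have "0 < fib (Suc d)" "fib (Suc (Suc d)) \<le> 2 * fib (Suc d)"
    by (simp add: fib_neq_0_nat) (rule fib_le_Suc_double)
  ultimately show ?thesis by linarith
next
  case False
  then have "even N" using assms by simp
  define d where "d = 2 * i - Suc (Suc N)"
  have i: "2 * i = Suc N + Suc d" "2 * i = Suc (Suc N) + d"
    using False \<open>even N\<close> unfolding d_def by presburger+
  have "int (peak J 1 2 (Suc i)) - int (peak J 1 2 i) = 3 * int (fib (Suc d)) + int (fib d)"
    using fib_dOcagne[of "Suc N" "Suc d"] fib_dOcagne[of "Suc (Suc N)" d] \<open>even N\<close>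
    unfolding peak_1_2_diff[OF J] i(1)[symmetric] i(2)[symmetric] by (simp add: mult.commute del: fib.simps)
  moreover have "0 < fib (Suc d)" by (simp add: fib_neq_0_nat)
  ultimately show ?thesis by linarith
qed

lemma peak_1_2_decreasing:
  assumes J: "J = 2 * i + N + 3" "1 \<le> N" and "N < 2 * i" "odd N"
  shows "peak J 1 2 (Suc i) \<le> peak J 1 2 i"
proof (cases "2 * i = Suc N")
  case True
  \<comment> \<open>At this turning point the difference is exactly -1.\<close>
  show ?thesis
    using fib_dOcagne[of "2 * i" 0] fib_dOcagne[of "2 * i" 1] peak_1_2_diff[OF J]
    unfolding True[symmetric] by (simp add: mult.commute del: fib.simps(3))
next
  case False
  define d where "d = 2 * i - Suc (Suc N)"
  have i: "2 * i = Suc N + Suc d" "2 * i = Suc (Suc N) + d"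
    using False \<open>N < 2 * i\<close> unfolding d_def by presburger+
  have "int (peak J 1 2 (Suc i)) - int (peak J 1 2 i) = - (3 * int (fib (Suc d)) + int (fib d))"
    using fib_dOcagne[of "Suc N" "Suc d"] fib_dOcagne[of "Suc (Suc N)" d] \<open>odd N\<close>
    unfolding peak_1_2_diff[OF J] i(1)[symmetric] i(2)[symmetric] by (simp add: mult.commute del: fib.simps)
  then show ?thesis by linarith
qed

section \<open>The subtrees below 1000 and 100100\<close>

lemma recs_1000:
  assumes "j \<in> {1, 2}" "2 \<le> r"
  shows "recs (2 * r + j) (fib (2 * r + j + 4)) 1 (1 + 3) = [rep r [1,0] @ replicate j 1]"
proof (rule recs_single[OF assms(1)])
  show "1 \<le> fib (2 * r + j + 4)" by (simp add: Suc_leI fib_neq_0_nat)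
next
  fix i N assume N: "2 * r + j = Suc (2 * i + N)" "1 \<le> N"
  have eq: "2 * r + j + 4 = 2 * i + N + 5" using N(1) by simp
  show "branch_max N (pre_fst 1 3 i) (pre_snd 1 3 i) \<le> fib (2 * r + j + 4)"
    unfolding eq by (rule branch_dominated_fib[OF N(2)])
next
  define q where "q = 2 * r + j - 1"
  have q: "2 * r + j = Suc q" "0 < q" using assms by (auto simp: q_def)
  \<comment> \<open>The right side is larger by \<open>fib q\<close>.\<close>
  show "fib (2 * r + j + 4) < fib (2 * r + j) * 1 + fib (Suc (2 * r + j)) * (1 + 3)"
    using fib_neq_0_nat[OF q(2)] unfolding q(1) by (simp add: eval_nat_numeral)
qed

text \<open>Here \<open>N\<close> is odd at every branch, so the exception \<open>N = 2\<close> does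
  not occur.\<close>

lemma recs_100100_odd_height:
  assumes "1 \<le> r" "peak (2 * r + 5) 1 2 0 < peak (2 * r + 5) 1 2 1"
  shows "recs (2 * r + 2) (peak (2 * r + 5) 1 2 0) 4 (4 + 7) = [rep r [1,0] @ [1,1]]"
proof -
  have m: "peak (2 * r + 5) 1 2 0 = branch_max (2 * r + 4) 1 3"
    by (simp add: peak_def add.commute numeral_3_eq_3)
  have "recs (2 * r + 2) (peak (2 * r + 5) 1 2 0) 4 (4 + 7) = [rep r [1,0] @ replicate 2 1]"
  proof (rule recs_single)
    have "0 < fib (Suc (r + r))" by (simp add: fib_neq_0_nat)
    then show "4 \<le> peak (2 * r + 5) 1 2 0"
      unfolding m by (simp add: branch_max_def eval_nat_numeral)
  next
    fix i N assume N: "2 * r + 2 = Suc (2 * i + N)" "1 \<le> N"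
    then have eq: "2 * r + 4 = 2 * i + N + 3" by simp
    have "N \<noteq> 2" using N(1) by presburger
    with N(2) show "branch_max N (pre_fst 4 7 i) (pre_snd 4 7 i) \<le> peak (2 * r + 5) 1 2 0"
      unfolding m eq by (rule branch_dominated_1_3)
  next
    have "peak (2 * r + 5) 1 2 1 = fib (2 * r + 2) * 4 + fib (Suc (2 * r + 2)) * (4 + 7)"
      by (simp add: peak_def branch_max_def pre_fst_def pre_snd_def eval_nat_numeral)
    then show "peak (2 * r + 5) 1 2 0 < fib (2 * r + 2) * 4 + fib (Suc (2 * r + 2)) * (4 + 7)"
      using assms(2) by linarith
  qed simp
  moreover have "replicate 2 1 = [1, 1 :: nat]" by (simp add: numeral_2_eq_2)
  ultimately show ?thesis by (simp only:)
qed

text \<open>Here \<open>N\<close> is even and equals 2 at \<open>i = r\<close>, so the path is cut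
  three digits before the end and the last node is evaluated directly.\<close>

lemma recs_100100_even_height:
  assumes "2 \<le> r"
  shows "recs (2 * r + 3) (peak (2 * r + 6) 1 2 0) 4 (4 + 7) =
    [rep r [1,0] @ [0,1,1], rep (Suc r) [1,0] @ [1]]"
proof -
  let ?m = "peak (2 * r + 6) 1 2 0" and ?P = "pre_fst 4 7 r" and ?Q = "pre_snd 4 7 r"
  have m: "?m = branch_max (2 * r + 5) 1 3" by (simp add: peak_def add.commute numeral_3_eq_3)
  have dom: "branch_max N (pre_fst 4 7 i) (pre_snd 4 7 i) \<le> ?m" if "i < r" "2 * r + 3 = Suc (2 * i + N)" for i N
  proof -
    have eq: "2 * r + 5 = 2 * i + N + 3" and "1 \<le> N" "N \<noteq> 2" using that by linarith+
    then show ?thesis unfolding m eq by (intro branch_dominated_1_3)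
  qed
  have "recs (2 * r + 3 - Suc (2 * i)) ?m (pre_fst 4 7 i) (pre_fst 4 7 i + pre_snd 4 7 i) = []" if "i < r" for i
    using that by (intro recs_pruned, unfold row_max_branch, intro dom) auto
  then have "concat (map (\<lambda>i. map (\<lambda>w. rep i [1,0] @ 0 # w)
      (recs (2 * r + 3 - Suc (2 * i)) ?m (pre_fst 4 7 i) (pre_fst 4 7 i + pre_snd 4 7 i))) [0..<r]) = []"
    by simp
  moreover have "?m = max ?m (branch_max N (pre_fst 4 7 i) (pre_snd 4 7 i))"
    if "i < r" "2 * r + 3 = Suc (2 * i + N)" for i N
    using dom[OF that] by simp
  ultimately have 1: "recs (2 * r + 3) ?m 4 (4 + 7) = map ((@) (rep r [1,0])) (recs 3 ?m ?P ?Q)"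
    using recs_alternating[where mm = "\<lambda>_. ?m" and j = 3 and r = r and p = 4 and e = 7] by simp
  define s where "s = 2 * r - 3"
  have r: "2 * r = Suc (Suc (Suc s))"
    using assms by (simp add: s_def)
  have five: "2 * r + 2 + 3 = 2 * r + 5" by simp
  \<comment> \<open>At \<open>N = 2\<close> the gap is negative for \<open>2 \<le> r\<close>: the
    value \<open>3 P + 2 Q\<close> at \<open>011\<close> beats the threshold, while
    \<open>3 P + Q\<close> at \<open>001\<close> does not.\<close>
  have "int (branch_max (2 * r + 2 + 3) 1 3) = int (branch_max 2 ?P ?Q)
      + 3 * int (fib (Suc (2 * r))) - 6 * int (fib (2 * r))"
    using dominance_gap[of 2 r 1 3] by (simp add: eval_nat_numeral)
  moreover have "branch_max 2 ?P ?Q = 3 * ?P + 2 * ?Q" by (simp add: branch_max_def eval_nat_numeral)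
  moreover have "fib (Suc (2 * r)) < 2 * fib (2 * r)" unfolding r using fib_neq_0_nat[of "Suc s"] by simp
  moreover have "?Q = 4 * fib (2 * r) + 11 * fib (Suc (2 * r))" by (simp add: pre_snd_def)
  moreover have "fib (2 * r) \<le> fib (Suc (2 * r))" by (rule fib_Suc_mono)
  ultimately have "3 * ?P + ?Q \<le> ?m" "?m < 3 * ?P + 2 * ?Q" unfolding m five by linarith+
  moreover have "?P < ?Q"
    using fib_Suc_mono[of "2 * r"] fib_neq_0_nat[of "Suc (2 * r)"] by (simp add: pre_fst_def pre_snd_def)
  ultimately have "recs 3 ?m ?P ?Q = [[0,1,1], [1,0,1]]"
    by (simp add: recs.simps row_max.simps eval_nat_numeral max_def)
  then show ?thesis unfolding 1 by (simp add: rep_Suc_right)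
qed

lemma fib_le_peak_1_2: "fib (J + 3) \<le> peak J 1 2 0" if "2 \<le> J"
proof -
  define q where "q = J - 2"
  have J: "J = Suc (Suc q)" using that by (simp add: q_def)
  show ?thesis
    unfolding J using fib_Suc_mono[of q] by (simp add: peak_def branch_max_def eval_nat_numeral)
qed

lemma peak_0_1_0: "0 < J \<Longrightarrow> peak (Suc J) 0 1 0 = fib (Suc J)"
  by (simp add: peak_def branch_max_def)

lemma recs_0_pruned: "recs J (fib (Suc J)) 0 1 = []"
  using row_max_branch[of J 0 1] by (intro recs_pruned) (simp add: branch_max_def)

section \<open>The list of record-setters\<close>

text \<open>\<open>recs_unimodal\<close> is used at the root and in its branch 1, the node
  \<open>100\<close>. The even height at the root makes the peaks rise up to \<open>n div 2\<close>;
  below \<open>100\<close> the height is odd and all but the last peak rise.\<close>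

lemma recs_even:
  assumes "6 \<le> n"
  shows "recs (2 * n) (fib (2 * n)) 0 1 = even_list n"
proof -
  define r where "r = n - 4"
  have n: "n = r + 4" "2 \<le> r" using assms by (simp_all add: r_def)
  have inc: "peak (2 * r + 5) 1 2 i < peak (2 * r + 5) 1 2 (Suc i)" if "i \<le> r" for i
    using that by (intro peak_1_2_increasing[where N = "2 * r + 2 - 2 * i"]) auto
  have "recs (2 * (r + 2) + 1) (fib (2 * n)) 1 (1 + 2) =
    map (Cons 0) (recs (2 * (r + 2) + 1 - 1) (fib (2 * n)) 1 (1 + (1 + 2)))
    @ map (\<lambda>w. 1 # 0 # 0 # w) (recs (2 * (r + 2) + 1 - 3) (peak (2 * (r + 2) + 1) 1 2 0)
        (2 * 1 + 2) ((2 * 1 + 2) + (3 * 1 + 2 * 2)))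
    @ [rep i [1,0] @ [0] @ rep (r + 2 + 1 - 2 - i) [1,0] @ replicate (3 - 1) 1. i \<leftarrow> [2..<Suc (r + 1)]]
    @ [rep (r + 2) [1,0] @ replicate 1 1]"
  proof (rule recs_unimodal)
    show "fib (2 * n) \<le> peak (2 * (r + 2) + 1) 1 2 0"
      using fib_le_peak_1_2[of "2 * r + 5"] n by (simp add: eval_nat_numeral)
  next
    fix i assume "i < r + 1"
    then show "peak (2 * (r + 2) + 1) 1 2 i < peak (2 * (r + 2) + 1) 1 2 (Suc i)"
      using inc[of i] by (simp add: eval_nat_numeral)
  next
    fix i assume "r + 1 \<le> i" "i < r + 2"
    then have "2 * (r + 2) + 1 = 2 * i + 3" by simp
    then show "peak (2 * (r + 2) + 1) 1 2 (Suc i) \<le> peak (2 * (r + 2) + 1) 1 2 i"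
      using peak_Suc_le_last[of i 1 2] by (simp only:)
  qed (use n in auto)
  moreover have "recs (2 * (r + 2) + 1 - 1) (fib (2 * n)) 1 (1 + (1 + 2)) = [rep (r + 1) [1,0] @ [1,1]]"
    using recs_1000[of 2 "r + 1"] n by (simp add: eval_nat_numeral)
  moreover have "recs (2 * (r + 2) + 1 - 3) (peak (2 * (r + 2) + 1) 1 2 0)
        (2 * 1 + 2) ((2 * 1 + 2) + (3 * 1 + 2 * 2)) = [rep r [1,0] @ [1,1]]"
    using recs_100100_odd_height[of r] inc[of 0] n by (simp add: eval_nat_numeral)
  \<comment> \<open>The subtrees \<open>1000\<close> and \<open>100100\<close> supply
    \<open>a = 0\<close> and \<open>a = 1\<close>.\<close>
  ultimately have level2: "recs (2 * (r + 2) + 1) (fib (2 * n)) 1 (1 + 2) =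
    [rep a [1,0] @ [0] @ rep (n - 3 - a) [1,0] @ [1,1]. a \<leftarrow> [0..<n - 2]] @ [rep (n - 2) [1,0] @ [1]]"
    using n by (simp add: upt_conv_Cons rep_Suc eval_nat_numeral)
  have "2 * (n - 1) + 2 = Suc (2 * n - 1)" "2 * n = Suc (2 * n - 1)" "0 < 2 * n - 1" using assms by simp_all
  then have peak: "peak (2 * (n - 1) + 2) 0 1 0 = fib (2 * n)" by (metis peak_0_1_0)
  have "recs (2 * (n - 1) + 2) (fib (2 * n)) 0 (0 + 1) =
    map (Cons 0) (recs (2 * (n - 1) + 2 - 1) (fib (2 * n)) 0 (0 + (0 + 1)))
    @ map (\<lambda>w. 1 # 0 # 0 # w) (recs (2 * (n - 1) + 2 - 3) (peak (2 * (n - 1) + 2) 0 1 0)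
        (2 * 0 + 1) ((2 * 0 + 1) + (3 * 0 + 2 * 1)))
    @ [rep i [1,0] @ [0] @ rep (n - 1 + 2 - 2 - i) [1,0] @ replicate (3 - 2) 1. i \<leftarrow> [2..<Suc (n div 2)]]
    @ [rep (n - 1) [1,0] @ replicate 2 1]"
  proof (rule recs_unimodal)
    show "fib (2 * n) \<le> peak (2 * (n - 1) + 2) 0 1 0"
      by (simp only: peak)
  next
    fix i assume i: "i < n div 2"
    show "peak (2 * (n - 1) + 2) 0 1 i < peak (2 * (n - 1) + 2) 0 1 (Suc i)"
      by (rule peak_0_1_increasing[where N = "2 * n - 3 - 2 * i"]) (use i assms in auto)
  next
    fix i assume i: "n div 2 \<le> i" "i < n - 1"
    have "2 * n - 3 - 2 * i = Suc (2 * (n - 2 - i))" using i assms by simp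
    then have "odd (2 * n - 3 - 2 * i)" by simp
    then show "peak (2 * (n - 1) + 2) 0 1 (Suc i) \<le> peak (2 * (n - 1) + 2) 0 1 i"
      by (intro peak_0_1_decreasing[where N = "2 * n - 3 - 2 * i"]) (use i assms in auto)
  qed (use assms in auto)
  moreover have "recs (2 * (n - 1) + 2 - 1) (fib (2 * n)) 0 (0 + (0 + 1)) = []"
    using recs_0_pruned[of "2 * n - 1"] assms by (simp add: n add.commute)
  moreover note peak
  moreover have "2 * (n - 1) + 2 - 3 = 2 * (r + 2) + 1" using n by simp
  moreover have "2 * 0 + 1 = (1 :: nat)" "(1 :: nat) + (3 * 0 + 2 * 1) = 1 + 2" "0 + 1 = (1 :: nat)"
    "2 * (n - 1) + 2 = 2 * n" "3 - 2 = (1 :: nat)" "n - 1 + 2 - 2 = n - 1"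
    using assms by simp_all
  ultimately have "recs (2 * n) (fib (2 * n)) 0 1 =
    map (\<lambda>w. 1 # 0 # 0 # w) (recs (2 * (r + 2) + 1) (fib (2 * n)) 1 (1 + 2))
    @ [rep i [1,0] @ [0] @ rep (n - 1 - i) [1,0] @ replicate 1 1. i \<leftarrow> [2..<Suc (n div 2)]]
    @ [rep (n - 1) [1,0] @ replicate 2 1]"
    by (simp only: list.map append_Nil)
  \<comment> \<open>The entry \<open>b = 1\<close> is the last record below
    \<open>100\<close>.\<close>
  moreover have "[rep b [1,0] @ [0] @ rep (n - b - 1) [1,0] @ [1]. b \<leftarrow> [1..<n div 2 + 1]] =
    ([1,0,0] @ rep (n - 2) [1,0] @ [1]) #
    [rep i [1,0] @ [0] @ rep (n - 1 - i) [1,0] @ [1]. i \<leftarrow> [2..<Suc (n div 2)]]"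
  proof -
    have "[1..<n div 2 + 1] = 1 # [Suc 1..<n div 2 + 1]"
      using assms by (intro upt_conv_Cons) simp
    then show ?thesis by (simp add: rep_Suc numeral_2_eq_2 del: upt_Suc)
  qed
  ultimately show ?thesis
    unfolding level2 even_list_def by (simp add: numeral_2_eq_2 o_def del: upt_Suc)
qed

text \<open>The parities are exchanged: all but the last peak rise at the root, those below
  \<open>100\<close> only up to \<open>c\<close>, and \<open>100100\<close> yields the exceptional
  record as well as \<open>b = 1\<close>.\<close>

lemma recs_odd:
  assumes "6 \<le> n"
  shows "recs (2 * n + 1) (fib (2 * n + 1)) 0 1 = odd_list n"
proof -
  define r where "r = n - 4"
  have n: "n = r + 4" "2 \<le> r" using assms by (simp_all add: r_def)
  define c where "c = (n - 1) div 2"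
  have c: "1 \<le> c" "c < r + 2" "2 * c + 1 \<le> n" "n \<le> 2 * c + 2" using n by (auto simp: c_def)
  have "recs (2 * (r + 2) + 2) (fib (2 * n + 1)) 1 (1 + 2) =
    map (Cons 0) (recs (2 * (r + 2) + 2 - 1) (fib (2 * n + 1)) 1 (1 + (1 + 2)))
    @ map (\<lambda>w. 1 # 0 # 0 # w) (recs (2 * (r + 2) + 2 - 3) (peak (2 * (r + 2) + 2) 1 2 0)
        (2 * 1 + 2) ((2 * 1 + 2) + (3 * 1 + 2 * 2)))
    @ [rep i [1,0] @ [0] @ rep (r + 2 + 2 - 2 - i) [1,0] @ replicate (3 - 2) 1. i \<leftarrow> [2..<Suc c]]
    @ [rep (r + 2) [1,0] @ replicate 2 1]"
  proof (rule recs_unimodal)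
    show "fib (2 * n + 1) \<le> peak (2 * (r + 2) + 2) 1 2 0"
      using fib_le_peak_1_2[of "2 * r + 6"] n by (simp add: eval_nat_numeral)
  next
    fix i assume i: "i < c"
    show "peak (2 * (r + 2) + 2) 1 2 i < peak (2 * (r + 2) + 2) 1 2 (Suc i)"
      by (rule peak_1_2_increasing[where N = "2 * r + 3 - 2 * i"]) (use i n c in auto)
  next
    fix i assume i: "c \<le> i" "i < r + 2"
    have "2 * r + 3 - 2 * i = Suc (2 * (r + 1 - i))" using i by simp
    then have "odd (2 * r + 3 - 2 * i)" by simp
    then show "peak (2 * (r + 2) + 2) 1 2 (Suc i) \<le> peak (2 * (r + 2) + 2) 1 2 i"
      by (intro peak_1_2_decreasing[where N = "2 * r + 3 - 2 * i"]) (use i n c in auto)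
  qed (use c in auto)
  moreover have "recs (2 * (r + 2) + 2 - 1) (fib (2 * n + 1)) 1 (1 + (1 + 2)) = [rep (r + 2) [1,0] @ [1]]"
    using recs_1000[of 1 "r + 2"] n by (simp add: eval_nat_numeral)
  moreover have "recs (2 * (r + 2) + 2 - 3) (peak (2 * (r + 2) + 2) 1 2 0)
      (2 * 1 + 2) ((2 * 1 + 2) + (3 * 1 + 2 * 2)) = [rep r [1,0] @ [0,1,1], rep (Suc r) [1,0] @ [1]]"
    using recs_100100_even_height[of r] n by (simp add: eval_nat_numeral)
  moreover have "[1..<(n + 1) div 2] = 1 # [2..<Suc c]"
  proof -
    have "(n + 1) div 2 = Suc c" using c by linarith
    then show ?thesis using c by (simp add: upt_conv_Cons numeral_2_eq_2 del: upt_Suc)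
  qed
  ultimately have level2: "recs (2 * (r + 2) + 2) (fib (2 * n + 1)) 1 (1 + 2) =
    [[0] @ rep (n - 2) [1,0] @ [1], [1,0,0] @ rep (n - 4) [1,0] @ [0,1,1]]
    @ [rep b [1,0] @ [0] @ rep (n - 2 - b) [1,0] @ [1]. b \<leftarrow> [1..<(n + 1) div 2]]
    @ [rep (n - 2) [1,0] @ [1,1]]"
    using n by (simp add: rep_Suc eval_nat_numeral del: upt_Suc)
  have "recs (2 * n + 1) (fib (2 * n + 1)) 0 (0 + 1) =
    map (Cons 0) (recs (2 * n + 1 - 1) (fib (2 * n + 1)) 0 (0 + (0 + 1)))
    @ map (\<lambda>w. 1 # 0 # 0 # w) (recs (2 * n + 1 - 3) (peak (2 * n + 1) 0 1 0)
        (2 * 0 + 1) ((2 * 0 + 1) + (3 * 0 + 2 * 1)))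
    @ [rep i [1,0] @ [0] @ rep (n + 1 - 2 - i) [1,0] @ replicate (3 - 1) 1. i \<leftarrow> [2..<Suc (n - 1)]]
    @ [rep n [1,0] @ replicate 1 1]"
  proof (rule recs_unimodal)
    show "fib (2 * n + 1) \<le> peak (2 * n + 1) 0 1 0"
      using peak_0_1_0[of "2 * n"] assms by simp
  next
    fix i assume i: "i < n - 1"
    show "peak (2 * n + 1) 0 1 i < peak (2 * n + 1) 0 1 (Suc i)"
      by (rule peak_0_1_increasing[where N = "2 * (n - 1 - i)"]) (use i in auto)
  next
    fix i assume "n - 1 \<le> i" "i < n"
    then have "2 * n + 1 = 2 * i + 3" by simp
    then show "peak (2 * n + 1) 0 1 (Suc i) \<le> peak (2 * n + 1) 0 1 i"
      using peak_Suc_le_last[of i 0 1] by (simp only:)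
  qed (use assms in auto)
  moreover have "recs (2 * n + 1 - 1) (fib (2 * n + 1)) 0 (0 + (0 + 1)) = []"
    using recs_0_pruned[of "2 * n"] by simp
  moreover have "peak (2 * n + 1) 0 1 0 = fib (2 * n + 1)"
    using peak_0_1_0[of "2 * n"] assms by simp
  moreover have "2 * n + 1 - 3 = 2 * (r + 2) + 2" using n by simp
  moreover have "2 * 0 + 1 = (1 :: nat)" "(1 :: nat) + (3 * 0 + 2 * 1) = 1 + 2" "0 + 1 = (1 :: nat)"
    "3 - 1 = (2 :: nat)"
    by simp_all
  ultimately have "recs (2 * n + 1) (fib (2 * n + 1)) 0 1 =
    map (\<lambda>w. 1 # 0 # 0 # w) (recs (2 * (r + 2) + 2) (fib (2 * n + 1)) 1 (1 + 2))
    @ [rep i [1,0] @ [0] @ rep (n + 1 - 2 - i) [1,0] @ replicate 2 1. i \<leftarrow> [2..<Suc (n - 1)]]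
    @ [rep n [1,0] @ replicate 1 1]"
    by (simp only: list.map append_Nil)
  \<comment> \<open>The entry \<open>a = 0\<close> is the last record below
    \<open>100\<close>.\<close>
  moreover have "[rep (a + 1) [1,0] @ [0] @ rep (n - 2 - a) [1,0] @ [1,1]. a \<leftarrow> [0..<n - 1]] =
    ([1,0,0] @ rep (n - 2) [1,0] @ [1,1]) #
    [rep i [1,0] @ [0] @ rep (n + 1 - 2 - i) [1,0] @ [1,1]. i \<leftarrow> [2..<Suc (n - 1)]]"
  proof -
    have "[2..<Suc (n - 1)] = map Suc [1..<n - 1]" by (simp add: map_Suc_upt numeral_2_eq_2)
    moreover have "[0..<n - 1] = 0 # [1..<n - 1]" using n by (simp add: upt_conv_Cons)
    ultimately show ?thesis by (simp add: rep_Suc o_def numeral_2_eq_2 del: upt_Suc)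
  qed
  ultimately show ?thesis
    unfolding level2 odd_list_def by (simp add: numeral_2_eq_2 o_def del: upt_Suc)
qed

theorem theorem1:
  shows "rs_set 1 = {1} \<and> rs_set 2 = {3} \<and> rs_set 3 = {5} \<and> rs_set 4 = {9, 11}
    \<and> rs_set 5 = {19, 21} \<and> rs_set 6 = {35, 37, 43}
    \<and> rs_set 7 = {69, 73, 75, 83, 85} \<and> rs_set 8 = {139, 147, 149, 165, 171}
    \<and> rs_set 9 = {277, 293, 299, 331, 339, 341}
    \<and> rs_set 10 = {555, 587, 595, 597, 661, 683}
    \<and> rs_set 11 = {1109, 1173, 1189, 1195, 1323, 1355, 1363, 1365}
    \<and> (\<forall>n. 12 \<le> 2 * n \<longrightarrow> sorted_list_of_set (rs_set (2 * n)) = map bin (even_list n))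
    \<and> (\<forall>n. 12 \<le> 2 * n + 1 \<longrightarrow> sorted_list_of_set (rs_set (2 * n + 1)) = map bin (odd_list n))
    \<and> (\<forall>k\<ge>12. int (card (rs_set k)) = int (3 * k div 4) - (-1) ^ k)"
proof -
  have even: "sorted_list_of_set (rs_set (2 * n)) = map bin (even_list n)" if "12 \<le> 2 * n" for n
    using that rs_set_eq_recs(2)[of "2 * n"] recs_even[of n] by simp
  have odd: "sorted_list_of_set (rs_set (2 * n + 1)) = map bin (odd_list n)" if "12 \<le> 2 * n + 1" for n
    using that rs_set_eq_recs(2)[of "2 * n + 1"] recs_odd[of n] by simp
  have "int (card (rs_set k)) = int (3 * k div 4) - (-1) ^ k" if "12 \<le> k" for k
  proof (cases "even k")
    case True
    then obtain n where k: "k = 2 * n" by (elim evenE)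
    have "card (rs_set k) = length (even_list n)"
      using arg_cong[OF even[of n], of length] that by (simp add: k)
    also have "\<dots> = n - 2 + n div 2 + 1" by (simp add: even_list_def)
    finally show ?thesis using that unfolding k by simp
  next
    case False
    then obtain n where k: "k = 2 * n + 1" by (elim oddE)
    have "card (rs_set k) = length (odd_list n)"
      using arg_cong[OF odd[of n], of length] that by (simp add: k)
    also have "\<dots> = 2 + ((n + 1) div 2 - 1) + (n - 1) + 1" by (simp add: odd_list_def)
    finally show ?thesis using that unfolding k by simp
  qed
  moreover have "rs_set 1 = {1}"
    by (auto simp: rs_set_def record_setter_def)
  ultimately show ?thesis using even odd rs_set_small by simp
qed

end
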